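(* Let $m\ge 2$, let $T\ge1$ be an integer, and let $\gamma\colon\mathbb{N}^m\to(0,1)$ and $\alpha\colon\mathbb{N}^m\to(0,\infty)$ be $T$-diagonal-periodic, i.e. $\gamma(t+T\cdot{\bf 1})=\gamma(t)$ and $\alpha(t+T\cdot{\bf 1})=\alpha(t)$ for all $t\in\mathbb{N}^m$. Consider the second order homogeneous diagonal recurrence equation $$Y(t+2\cdot{\bf 1})-\big(\gamma(t+{\bf 1})+\alpha(t+{\bf 1})\big)Y(t+{\bf 1})+\alpha(t+{\bf 1})Y(t)=0,\qquad t\in\mathbb{N}^m,$$ with monodromy matrix $D(t)$. Then, for each $t\in\mathbb{N}^m$, the Floquet multipliers of this recurrence equation are the two roots (counted with multiplicity) of the quadratic equation $$z^2-z\,\mathrm{Tr}\,D(t)+\Delta(t)=0,$$ where $$\Delta(t)=\det D(t)=\alpha\big(t+(T-\mu(t))\cdot{\bf 1}\big)\cdots\alpha\big(t+(1-\mu(t))\cdot{\bf 1}\big)=\prod_{j=1}^{T}\alpha\big(t+(j-\mu(t))\cdot{\bf 1}\big).$$ These multipliers depend on $t$ through $t^1-\mu(t),\ldots,t^m-\mu(t)$.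
   Context: $\mathbb{N}=\{0,1,2,\ldots\}$. For $t=(t^1,\ldots,t^m)\in\mathbb{N}^m$, $\mu(t)=\min\{t^1,\ldots,t^m\}$, and ${\bf 1}=(1,\ldots,1)\in\mathbb{N}^m$. With $Z(t)=Y(t+{\bf 1})$, the second order equation is equivalent to the first order diagonal recurrence system $$\begin{pmatrix}Y(t+{\bf 1})\\ Z(t+{\bf 1})\end{pmatrix}=A(t+{\bf 1})\begin{pmatrix}Y(t)\\ Z(t)\end{pmatrix},\qquad A(t)=\begin{pmatrix}0&1\\-\alpha(t)&\gamma(t)+\alpha(t)\end{pmatrix}.$$ The monodromy matrix of this system (and of the second order equation) is the $2\times2$ matrix $$D(t)=\prod_{k=0}^{T-1}A\big(t+(T-k-\mu(t))\cdot{\bf 1}\big)=A\big(t+(T-\mu(t))\cdot{\bf 1}\big)A\big(t+(T-1-\mu(t))\cdot{\bf 1}\big)\cdots A\big(t+(1-\mu(t))\cdot{\bf 1}\big),$$ the product being ordered with $k$ increasing from left to right. A Floquet multiplier (at $t$) of the second order equation is an eigenvalue of $D(t)$. *)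

theory Defs
  imports "Jordan_Normal_Form.Char_Poly" "HOL-Library.Cardinality"
begin

text \<open>A multi-time in \<open>\<nat>\<^sup>m\<close> is a function \<open>t :: 'm \<Rightarrow> nat\<close> on a finite index type
  with \<open>CARD('m) = m\<close>.\<close>

definition mu :: "('m::finite \<Rightarrow> nat) \<Rightarrow> nat" where
  "mu t = Min (range t)"

text \<open>\<open>diag_shift t k\<close> is \<open>t + k \<cdot> 1\<close> for a possibly negative integer \<open>k\<close>. It is only used with
  \<open>k \<ge> - mu t\<close>, where the conversion to \<open>nat\<close> does not truncate.\<close>

definition diag_shift :: "('m \<Rightarrow> nat) \<Rightarrow> int \<Rightarrow> 'm \<Rightarrow> nat" where
  "diag_shift t k = (\<lambda>i. nat (int (t i) + k))"

definition diag_periodic :: "nat \<Rightarrow> (('m \<Rightarrow> nat) \<Rightarrow> 'a) \<Rightarrow> bool" where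
  "diag_periodic T f \<longleftrightarrow> (\<forall>t. f (diag_shift t (int T)) = f t)"

definition solves_recurrence ::
  "(('m \<Rightarrow> nat) \<Rightarrow> real) \<Rightarrow> (('m \<Rightarrow> nat) \<Rightarrow> real) \<Rightarrow> (('m \<Rightarrow> nat) \<Rightarrow> real) \<Rightarrow> bool" where
  "solves_recurrence \<gamma> \<alpha> Y \<longleftrightarrow>
     (\<forall>t. Y (diag_shift t 2)
          - (\<gamma> (diag_shift t 1) + \<alpha> (diag_shift t 1)) * Y (diag_shift t 1)
          + \<alpha> (diag_shift t 1) * Y t = 0)"

definition companion ::
  "(('m \<Rightarrow> nat) \<Rightarrow> real) \<Rightarrow> (('m \<Rightarrow> nat) \<Rightarrow> real) \<Rightarrow> ('m \<Rightarrow> nat) \<Rightarrow> real mat" where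
  "companion \<gamma> \<alpha> t = mat_of_rows_list 2 [[0, 1], [- \<alpha> t, \<gamma> t + \<alpha> t]]"

text \<open>The equivalence between the second order recurrence and the first order system with
  matrix \<open>companion \<gamma> \<alpha>\<close>, which justifies attaching the monodromy matrix below to the
  recurrence.\<close>

lemma solves_recurrence_iff_first_order:
  "solves_recurrence \<gamma> \<alpha> Y \<longleftrightarrow>
     (\<exists>Z. (\<forall>t. Z t = Y (diag_shift t 1)) \<and>
          (\<forall>t. vec_of_list [Y (diag_shift t 1), Z (diag_shift t 1)]
               = companion \<gamma> \<alpha> (diag_shift t 1) *\<^sub>v vec_of_list [Y t, Z t]))"
proof -
  have sh: "diag_shift (diag_shift t 1) 1 = diag_shift t 2" for t :: "'a \<Rightarrow> nat"
    by (auto simp: diag_shift_def)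
  have mv: "companion \<gamma> \<alpha> s *\<^sub>v vec_of_list [a, b]
            = vec_of_list [b, - \<alpha> s * a + (\<gamma> s + \<alpha> s) * b]" for s a b
    by (rule eq_vecI)
      (auto simp: companion_def mat_of_rows_list_def scalar_prod_def less_Suc_eq)
  have eq: "vec_of_list [a, b] = vec_of_list [c, d] \<longleftrightarrow> a = c \<and> b = d" for a b c d :: real
  proof
    assume h: "vec_of_list [a, b] = vec_of_list [c, d]"
    have "list_of_vec (vec_of_list [a, b]) = list_of_vec (vec_of_list [c, d])"
      by (simp only: h)
    then show "a = c \<and> b = d"
      by (simp only: list_vec list.inject simp_thms)
  qed simp
  have ex: "(\<exists>Z. (\<forall>t. Z t = Y (diag_shift t 1)) \<and> P Z) \<longleftrightarrow> P (\<lambda>t. Y (diag_shift t 1))" for P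
    by (simp add: fun_eq_iff[symmetric])
  show ?thesis
    unfolding ex mv eq sh solves_recurrence_def by (auto simp: algebra_simps)
qed

text \<open>The factors are ordered with \<open>k\<close> increasing from left to right.\<close>

definition monodromy ::
  "(('m::finite \<Rightarrow> nat) \<Rightarrow> real) \<Rightarrow> (('m \<Rightarrow> nat) \<Rightarrow> real) \<Rightarrow> nat \<Rightarrow> ('m \<Rightarrow> nat) \<Rightarrow> real mat" where
  "monodromy \<gamma> \<alpha> T t =
     foldr (*) (map (\<lambda>k. companion \<gamma> \<alpha> (diag_shift t (int T - int k - int (mu t)))) [0..<T]) (1\<^sub>m 2)"

definition mat_trace :: "'a::comm_monoid_add mat \<Rightarrow> 'a" where
  "mat_trace A = (\<Sum>i<dim_row A. A $$ (i, i))"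

text \<open>The monodromy matrix is real, but its eigenvalues are taken in the complex numbers.\<close>

definition floquet_multiplier ::
  "(('m::finite \<Rightarrow> nat) \<Rightarrow> real) \<Rightarrow> (('m \<Rightarrow> nat) \<Rightarrow> real) \<Rightarrow> nat \<Rightarrow> ('m \<Rightarrow> nat) \<Rightarrow> complex \<Rightarrow> bool" where
  "floquet_multiplier \<gamma> \<alpha> T t z \<longleftrightarrow> eigenvalue (map_mat complex_of_real (monodromy \<gamma> \<alpha> T t)) z"

text \<open>The same eigenvalues, counted with algebraic multiplicity.\<close>

definition floquet_multipliers ::
  "(('m::finite \<Rightarrow> nat) \<Rightarrow> real) \<Rightarrow> (('m \<Rightarrow> nat) \<Rightarrow> real) \<Rightarrow> nat \<Rightarrow> ('m \<Rightarrow> nat) \<Rightarrow> complex multiset" where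
  "floquet_multipliers \<gamma> \<alpha> T t = proots (char_poly (map_mat complex_of_real (monodromy \<gamma> \<alpha> T t)))"

end

theory Submission
  imports Defs "HOL-Computational_Algebra.Fundamental_Theorem_Algebra"
begin

text \<open>The eigenvalues of a square matrix are the roots of its characteristic polynomial, and
  for a 2x2 matrix that polynomial is z^2 - z Tr + det (\<open>char_poly_2\<close>). Over the
  complex numbers it splits into two monic linear factors, which gives the multipliers with
  multiplicity (\<open>monic_quadratic_proots\<close>). The determinant is multiplicative and each
  companion factor has determinant \<alpha> at its own multi-time, so det D(t) is the stated product
  (\<open>det_monodromy\<close>). Finally, D(t) sees t only through points t + (k - mu(t)) 1 = (t -
  mu(t) 1) + k 1, so replacing t by t - mu(t) 1, whose minimum is 0, leaves D unchanged
  (\<open>monodromy_diff_mu\<close>).\<close>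

lemma det_2:
  fixes A :: "'a::comm_ring_1 mat"
  assumes A: "A \<in> carrier_mat 2 2"
  shows "det A = A $$ (0, 0) * A $$ (1, 1) - A $$ (0, 1) * A $$ (1, 0)"
proof -
  \<comment> \<open>Deleting row 0 and column j leaves a 1x1 matrix, whose entry sits in the other
    row and the other column, 1 - j.\<close>
  have single: "det (mat_delete A 0 j) = A $$ (1, 1 - j)" if "j < 2" for j
  proof -
    have "det (mat_delete A 0 j) = mat_delete A 0 j $$ (0, 0)"
      using A by (intro det_single) (auto simp: mat_delete_def)
    with A that show ?thesis
      by (auto simp: mat_delete_def less_Suc_eq numeral_2_eq_2)
  qed
  have "det A = (\<Sum>j<2. A $$ (0, j) * cofactor A 0 j)"
    using laplace_expansion_row[OF A, of 0] by simp
  then show ?thesis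
    by (simp add: cofactor_def single numeral_2_eq_2)
qed

lemma char_poly_2:
  fixes A :: "'a::comm_ring_1 mat"
  assumes A: "A \<in> carrier_mat 2 2"
  shows "char_poly A = [:det A, - mat_trace A, 1:]"
proof -
  have "char_poly_matrix A \<in> carrier_mat 2 2"
    using A by simp
  from det_2[OF this] show ?thesis
    using A by (simp add: char_poly_defs det_2[OF A] mat_trace_def numeral_2_eq_2)
qed

text \<open>The matrix type does not record dimensions, so \<open>det_mult\<close> needs the size of
  each partial product as a side condition.\<close>

lemma foldr_mult_carrier:
  assumes "\<And>A. A \<in> set As \<Longrightarrow> A \<in> carrier_mat n n"
  shows "foldr (*) As (1\<^sub>m n) \<in> carrier_mat n n"
  using assms by (induction As) (simp_all add: mult_carrier_mat[of _ n n])

lemma det_foldr_mult: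
  fixes As :: "'a::comm_ring_1 mat list"
  assumes "\<And>A. A \<in> set As \<Longrightarrow> A \<in> carrier_mat n n"
  shows "det (foldr (*) As (1\<^sub>m n)) = prod_list (map det As)"
  using assms
proof (induction As)
  case (Cons A As)
  have "foldr (*) As (1\<^sub>m n) \<in> carrier_mat n n"
    using Cons.prems by (intro foldr_mult_carrier) auto
  then have "det (A * foldr (*) As (1\<^sub>m n)) = det A * det (foldr (*) As (1\<^sub>m n))"
    using Cons.prems by (intro det_mult) auto
  with Cons show ?case by simp
qed simp

lemma companion_carrier [simp]: "companion \<gamma> \<alpha> t \<in> carrier_mat 2 2"
  by (rule carrier_matI) (simp_all add: companion_def mat_of_rows_list_def)

lemma det_companion: "det (companion \<gamma> \<alpha> t) = \<alpha> t"
  by (simp add: det_2[OF companion_carrier]) (simp add: companion_def mat_of_rows_list_def)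

lemma monodromy_carrier [simp]: "monodromy \<gamma> \<alpha> T t \<in> carrier_mat 2 2"
  unfolding monodromy_def by (rule foldr_mult_carrier) auto

lemma det_monodromy:
  "det (monodromy \<gamma> \<alpha> T t) = (\<Prod>j=1..T. \<alpha> (diag_shift t (int j - int (mu t))))"
proof -
  have "det (monodromy \<gamma> \<alpha> T t)
      = (\<Prod>k\<in>{0..<T}. \<alpha> (diag_shift t (int T - int k - int (mu t))))"
    unfolding monodromy_def
    by (subst det_foldr_mult)
      (auto simp: det_companion comp_def prod.distinct_set_conv_list[symmetric])
  also have "\<dots> = (\<Prod>j=1..T. \<alpha> (diag_shift t (int j - int (mu t))))"
    \<comment> \<open>The substitution j = T - k reverses the order of the factors and maps {0..<T}
      onto {1..T}; since k < T, the natural subtraction is exact.\<close>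
    by (rule prod.reindex_bij_witness[of _ "\<lambda>j. T - j" "\<lambda>k. T - k"]) (auto simp: of_nat_diff)
  finally show ?thesis .
qed

lemma mu_le: "mu t \<le> t i"
  by (simp add: mu_def)

text \<open>The minimum of finitely many coordinates is attained, and there the difference
  vanishes.\<close>

lemma mu_diff_mu: "mu (\<lambda>i. t i - mu t) = 0"
proof -
  have "Min (range t) \<in> range t"
    by (rule Min_in) auto
  then obtain i where "t i = mu t"
    unfolding mu_def by (metis imageE)
  then show ?thesis
    using mu_le[of "\<lambda>i. t i - mu t" i] by simp
qed

lemma monodromy_diff_mu: "monodromy \<gamma> \<alpha> T (\<lambda>i. t i - mu t) = monodromy \<gamma> \<alpha> T t"
proof -
  \<comment> \<open>On the left the inner \<open>mu\<close> is 0; as \<open>mu t \<le> t i\<close>,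
    the natural subtraction is exact, so both sides apply \<open>nat\<close> to the same
    integer.\<close>
  have "diag_shift (\<lambda>i. t i - mu t) (k - int (mu (\<lambda>i. t i - mu t)))
      = diag_shift t (k - int (mu t))" for k
    by (auto simp: diag_shift_def mu_diff_mu of_nat_diff mu_le algebra_simps)
  then show ?thesis
    by (simp add: monodromy_def)
qed

lemma monic_quadratic_proots:
  fixes b c :: complex
  obtains z1 z2 where "proots [:c, b, 1:] = {#z1, z2#}" "[:c, b, 1:] = [:-z1, 1:] * [:-z2, 1:]"
proof -
  \<comment> \<open>The fundamental theorem of algebra; the leading coefficient is 1, so no scalar
    factor remains, and the degree 2 is the number of roots.\<close>
  have "\<exists>A. size A = 2 \<and> [:c, b, 1:] = (\<Prod>x\<in>#A. [:-x, 1:])"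
    using alg_closed_imp_factorization[of "[:c, b, 1:]"] by (simp add: numeral_2_eq_2)
  then obtain A where A: "size A = 2" "[:c, b, 1:] = (\<Prod>x\<in>#A. [:-x, 1:])"
    by (elim exE conjE)
  obtain z1 N where N: "A = add_mset z1 N"
    using size_eq_Suc_imp_eq_union[of A 1] A(1) by auto
  then obtain z2 where "N = {#z2#}"
    using size_1_singleton_mset[of N] A(1) by auto
  with N have "A = {#z1, z2#}" by simp
  then have eq: "[:c, b, 1:] = [:-z1, 1:] * [:-z2, 1:]"
    using A(2) by (simp only: image_mset_add_mset image_mset_empty prod_mset.add_mset prod_mset.empty mult_1_right)
  moreover have "proots ([:-z1, 1:] * [:-z2, 1:]) = {#z1, z2#}"
    by (subst proots_mult) auto
  ultimately show ?thesis
    by (intro that) (simp_all only:)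
qed

theorem theorem5:
  fixes \<gamma> \<alpha> :: "('m::finite \<Rightarrow> nat) \<Rightarrow> real" and T :: nat
  assumes "CARD('m) \<ge> 2" and "T \<ge> 1"
    and "\<And>t. 0 < \<gamma> t \<and> \<gamma> t < 1" and "\<And>t. 0 < \<alpha> t"
    and "diag_periodic T \<gamma>" and "diag_periodic T \<alpha>"
  defines "D \<equiv> monodromy \<gamma> \<alpha> T"
  defines "\<Delta> \<equiv> (\<lambda>t. det (D t))"
  shows "(\<forall>t. (\<forall>z. floquet_multiplier \<gamma> \<alpha> T t z \<longleftrightarrow>
                  z^2 - z * of_real (mat_trace (D t)) + of_real (\<Delta> t) = 0)
            \<and> (\<exists>z1 z2. floquet_multipliers \<gamma> \<alpha> T t = {#z1, z2#} \<and>
                 (\<forall>z. z^2 - z * of_real (mat_trace (D t)) + of_real (\<Delta> t) = (z - z1) * (z - z2)))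
            \<and> \<Delta> t = (\<Prod>j=1..T. \<alpha> (diag_shift t (int j - int (mu t)))))
       \<and> (\<exists>\<Phi>. \<forall>t. floquet_multipliers \<gamma> \<alpha> T t = \<Phi> (\<lambda>i. t i - mu t))"
proof (intro conjI allI)
  fix t
  let ?A = "map_mat complex_of_real (D t)"
  let ?p = "[:complex_of_real (\<Delta> t), - complex_of_real (mat_trace (D t)), 1:]"
  have D: "D t \<in> carrier_mat 2 2"
    by (simp add: D_def)
  then have A: "?A \<in> carrier_mat 2 2"
    by simp
  have "mat_trace ?A = complex_of_real (mat_trace (D t))"
    using D by (simp add: mat_trace_def)
  \<comment> \<open>The embedding of the reals is a ring homomorphism, so it commutes with
    \<open>det\<close>, just as it does with the trace.\<close>
  then have cp: "char_poly ?A = ?p"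
    by (simp add: char_poly_2[OF A] of_real_hom.hom_det \<Delta>_def)
  have poly_p: "poly ?p z = z^2 - z * of_real (mat_trace (D t)) + of_real (\<Delta> t)" for z
    by (simp add: power2_eq_square algebra_simps)
  show "floquet_multiplier \<gamma> \<alpha> T t z \<longleftrightarrow>
      z^2 - z * of_real (mat_trace (D t)) + of_real (\<Delta> t) = 0" for z
    using eigenvalue_root_char_poly[OF A, of z] unfolding cp poly_p
    by (simp only: floquet_multiplier_def D_def)
  obtain z1 z2 where z: "proots ?p = {#z1, z2#}" "?p = [:-z1, 1:] * [:-z2, 1:]"
    by (rule monic_quadratic_proots)
  have "floquet_multipliers \<gamma> \<alpha> T t = {#z1, z2#}"
    using z(1) cp by (simp add: floquet_multipliers_def D_def)
  moreover have "z^2 - z * of_real (mat_trace (D t)) + of_real (\<Delta> t) = (z - z1) * (z - z2)" for z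
    unfolding poly_p[symmetric] z(2) poly_mult by simp
  ultimately show "\<exists>z1 z2. floquet_multipliers \<gamma> \<alpha> T t = {#z1, z2#} \<and>
      (\<forall>z. z^2 - z * of_real (mat_trace (D t)) + of_real (\<Delta> t) = (z - z1) * (z - z2))"
    by blast
  show "\<Delta> t = (\<Prod>j=1..T. \<alpha> (diag_shift t (int j - int (mu t))))"
    by (simp add: \<Delta>_def D_def det_monodromy)
next
  show "\<exists>\<Phi>. \<forall>t. floquet_multipliers \<gamma> \<alpha> T t = \<Phi> (\<lambda>i. t i - mu t)"
    \<comment> \<open>The multiplier map itself serves as \<Phi>, because the monodromy matrix is
      the same at t and at t - mu(t) 1.\<close>
    by (rule exI[of _ "floquet_multipliers \<gamma> \<alpha> T"])
      (simp add: floquet_multipliers_def monodromy_diff_mu)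
qed

end
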